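(* Given a non-empty set $A\subseteq\mathbb{Z}_m$ whose elements are given in sorted order (as integers in $\{0,\ldots,m-1\}$), the symmetry group $Sym(A)$ can be computed in time $O(|A|)$.
   Context: For $A\subseteq \mathbb{Z}_m$, the symmetry group of $A$ is $Sym(A)=\{h\in\mathbb{Z}_m : A+\{h\}=A\}$, where $A+\{h\}=\{a+h \bmod m: a\in A\}$; it is a subgroup of $\mathbb{Z}_m$. *)

theory Defs
  imports Main
begin

text \<open>
  Residue classes modulo \<open>m\<close> are represented by the naturals \<open>0, \<dots>, m - 1\<close>.
\<close>

definition Sym :: "nat \<Rightarrow> nat set \<Rightarrow> nat set" where
  "Sym m A = {h \<in> {..<m}. (\<lambda>a. (a + h) mod m) ` A = A}"

text \<open>
  Running time is measured on a word RAM with words of \<open>w\<close> bits: a fixed finite program acts on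
  registers and on a memory with indirect addressing; every instruction costs one step, and all
  arithmetic is modulo \<open>2 ^ w\<close>, so no unbounded work can be packed into a single step.
  The instruction set is minimal (no multiplication, division or bit operations).
  In \<open>Load r a\<close> and \<open>Store a r\<close> the register \<open>a\<close> holds the memory address.
\<close>

datatype instr =
    Const nat nat
  | Move nat nat
  | Add nat nat nat
  | Sub nat nat nat
  | Load nat nat
  | Store nat nat
  | Jump nat
  | JumpEq nat nat nat
  | JumpLess nat nat nat

record config =
  pc :: nat
  reg :: "nat \<Rightarrow> nat"
  mem :: "nat \<Rightarrow> nat"

definition set_reg :: "nat \<Rightarrow> nat \<Rightarrow> config \<Rightarrow> config" where
  "set_reg r v s = s\<lparr>pc := Suc (pc s), reg := (reg s)(r := v)\<rparr>"

fun exec_instr :: "nat \<Rightarrow> instr \<Rightarrow> config \<Rightarrow> config" where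
  "exec_instr w (Const r k) s = set_reg r (k mod 2 ^ w) s"
| "exec_instr w (Move r x) s = set_reg r (reg s x) s"
| "exec_instr w (Add r x y) s = set_reg r ((reg s x + reg s y) mod 2 ^ w) s"
| "exec_instr w (Sub r x y) s = set_reg r ((reg s x + (2 ^ w - reg s y)) mod 2 ^ w) s"
| "exec_instr w (Load r a) s = set_reg r (mem s (reg s a)) s"
| "exec_instr w (Store a r) s = s\<lparr>pc := Suc (pc s), mem := (mem s)(reg s a := reg s r)\<rparr>"
| "exec_instr w (Jump l) s = s\<lparr>pc := l\<rparr>"
| "exec_instr w (JumpEq x y l) s = s\<lparr>pc := (if reg s x = reg s y then l else Suc (pc s))\<rparr>"
| "exec_instr w (JumpLess x y l) s = s\<lparr>pc := (if reg s x < reg s y then l else Suc (pc s))\<rparr>"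

definition halted :: "instr list \<Rightarrow> config \<Rightarrow> bool" where
  "halted P s \<longleftrightarrow> length P \<le> pc s"

definition step :: "nat \<Rightarrow> instr list \<Rightarrow> config \<Rightarrow> config" where
  "step w P s = (if halted P s then s else exec_instr w (P ! pc s) s)"

text \<open>
  A list is stored with its length in register 1 and its entries in the memory cells
  \<open>0, 1, \<dots>\<close>; on input, register 0 holds the modulus. All else is initially zero.
\<close>

definition init_config :: "nat \<Rightarrow> nat list \<Rightarrow> config" where
  "init_config m xs =
    \<lparr>pc = 0,
     reg = (\<lambda>_. 0)(0 := m, 1 := length xs),
     mem = (\<lambda>i. if i < length xs then xs ! i else 0)\<rparr>"

definition output_list :: "config \<Rightarrow> nat list" where
  "output_list s = map (mem s) [0..<reg s 1]"

definition outputs_within ::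
    "nat \<Rightarrow> instr list \<Rightarrow> config \<Rightarrow> nat \<Rightarrow> nat list \<Rightarrow> bool" where
  "outputs_within w P s T ys \<longleftrightarrow>
    (\<exists>t\<le>T. halted P ((step w P ^^ t) s) \<and> output_list ((step w P ^^ t) s) = ys)"

end

theory Submission
  imports Defs
begin

text \<open>
  List the elements of \<open>A\<close> as \<open>a 0 < \<dots> < a (n - 1)\<close> and continue by
  \<open>a (x + n) = a x + m\<close> (\<open>a\<close> and its gaps \<open>d\<close> are \<open>ext\<close> and \<open>gap\<close> below). The
  symmetries of \<open>A\<close> are the differences \<open>a j - a 0\<close> for those \<open>j < n\<close> that are periods of the
  \<open>n\<close>-periodic gap sequence \<open>d x = a (x + 1) - a x\<close>, so it suffices to find its smallest period \<open>p\<close>.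
  This is done in linear time and constant extra space by the two-pointer search for a
  lexicographically least rotation: while the rotations at \<open>i\<close> and \<open>j\<close> agree on \<open>k\<close> entries, compare
  the next ones; if \<open>d (i + k) > d (j + k)\<close>, none of \<open>i, \<dots>, i + k\<close> starts a least rotation
  (\<open>j + t\<close> beats \<open>i + t\<close>), and \<open>i\<close> skips past them; symmetrically for \<open>j\<close>. If \<open>k\<close> reaches \<open>n\<close>
  then \<open>p = \<bar>i - j\<bar>\<close>; if a pointer leaves \<open>{0..<n}\<close>, the least rotation is unique and \<open>p = n\<close>.
  Every comparison increases \<open>2 * (i + j) + k\<close>, which is below \<open>5 * n\<close> while the search runs.
\<close>

subsection \<open>Periods and least rotations\<close>

locale cyclic_sequence =
  fixes d :: "nat \<Rightarrow> nat" and n :: nat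
  assumes n_pos: "0 < n" and d_add_n: "d (x + n) = d x"
begin

definition period :: "nat \<Rightarrow> bool" where
  "period q \<longleftrightarrow> (\<forall>x. d (x + q) = d x)"

definition minimal_period :: "nat \<Rightarrow> bool" where
  "minimal_period p \<longleftrightarrow> 0 < p \<and> period p \<and> (\<forall>q. 0 < q \<longrightarrow> period q \<longrightarrow> p \<le> q)"

definition lex_less :: "nat \<Rightarrow> nat \<Rightarrow> bool" where
  "lex_less x y \<longleftrightarrow> (\<exists>k. (\<forall>t<k. d (x + t) = d (y + t)) \<and> d (x + k) < d (y + k))"

text \<open>Positions are arbitrary naturals, not only those below \<open>n\<close>, and ties are
  allowed: a period below \<open>n\<close> makes several positions below \<open>n\<close>
  least.\<close>

definition least_rotation :: "nat \<Rightarrow> bool" where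
  "least_rotation x \<longleftrightarrow> (\<forall>y. \<not> lex_less y x)"

lemma period_n: "period n"
  by (simp add: period_def d_add_n)

lemma period_mult: "period q \<Longrightarrow> period (k * q)"
proof (induction k)
  case (Suc k)
  then show ?case
    unfolding period_def by (metis add.assoc add.commute mult_Suc)
qed (simp add: period_def)

lemma period_diff:
  assumes "period p" "period q" "p \<le> q"
  shows "period (q - p)"
  unfolding period_def
proof
  fix x
  have "d (x + (q - p)) = d (x + (q - p) + p)"
    using assms(1) by (simp add: period_def)
  also have "\<dots> = d (x + q)"
    using assms(3) by (simp add: add.assoc)
  finally show "d (x + (q - p)) = d x"
    using assms(2) by (simp add: period_def)
qed

lemma period_mod:
  assumes "period p" "period q"
  shows "period (q mod p)"
  using period_diff[OF period_mult[OF assms(1), of "q div p"] assms(2)]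
  by (simp add: minus_div_mult_eq_mod)

lemma minimal_period_dvd:
  assumes "minimal_period p" "period q"
  shows "p dvd q"
proof (rule ccontr)
  assume "\<not> p dvd q"
  then have "0 < q mod p" by (simp add: dvd_eq_mod_eq_0)
  moreover have "q mod p < p" using assms by (simp add: minimal_period_def)
  moreover have "period (q mod p)"
    using assms period_mod by (simp add: minimal_period_def)
  ultimately show False using assms(1) by (meson linorder_not_less minimal_period_def)
qed

section \<open>The lexicographic order on rotations\<close>

lemma lex_less_trans:
  assumes "lex_less x y" "lex_less y z"
  shows "lex_less x z"
proof -
  obtain k where k: "\<And>t. t < k \<Longrightarrow> d (x + t) = d (y + t)" "d (x + k) < d (y + k)"
    using assms(1) by (auto simp: lex_less_def)
  obtain l where l: "\<And>t. t < l \<Longrightarrow> d (y + t) = d (z + t)" "d (y + l) < d (z + l)"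
    using assms(2) by (auto simp: lex_less_def)
  have "d (x + min k l) < d (z + min k l)"
    using k l by (cases k l rule: linorder_cases) (auto simp: min_def)
  then show ?thesis
    unfolding lex_less_def using k(1) l(1) by (intro exI[of _ "min k l"]) auto
qed

lemma lex_less_irrefl: "\<not> lex_less x x"
  by (auto simp: lex_less_def)

lemma lex_less_cong:
  assumes "\<And>t. d (x + t) = d (x' + t)" "\<And>t. d (y + t) = d (y' + t)"
  shows "lex_less x y \<longleftrightarrow> lex_less x' y'"
  by (simp add: lex_less_def assms)

lemma d_mod:
  assumes "period q"
  shows "d (x mod q + t) = d (x + t)"
proof -
  have "d (x mod q + t + x div q * q) = d (x mod q + t)"
    using period_mult[OF assms] unfolding period_def by blast
  moreover have "x mod q + t + x div q * q = x + t"
    by (metis add.assoc add.commute div_mult_mod_eq)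
  ultimately show ?thesis by simp
qed

lemma least_rotation_mod: "period q \<Longrightarrow> least_rotation x \<Longrightarrow> least_rotation (x mod q)"
  unfolding least_rotation_def using lex_less_cong[OF refl d_mod] by metis

lemma least_rotation_add: "period q \<Longrightarrow> least_rotation x \<Longrightarrow> least_rotation (x + q)"
proof -
  assume q: "period q" and x: "least_rotation x"
  have "d (x + q + t) = d (x + t)" for t
    using q unfolding period_def by (metis add.assoc add.commute)
  then show ?thesis
    using x lex_less_cong[OF refl, of "x + q" x] unfolding least_rotation_def by simp
qed

text \<open>A strict order has a minimal element on the finite set \<open>{..<n}\<close>, and every
  position \<open>y\<close> has the same rotation as \<open>y mod n\<close>.\<close>

lemma ex_least_rotation: "\<exists>x. least_rotation x"
proof -
  have "\<exists>x\<in>S. \<forall>y\<in>S. \<not> lex_less y x" if "finite S" "S \<noteq> {}" for S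
    using that
  proof (induction S rule: finite_ne_induct)
    case (singleton x)
    then show ?case by (simp add: lex_less_irrefl)
  next
    case (insert a S)
    then obtain x where "x \<in> S" "\<forall>y\<in>S. \<not> lex_less y x" by blast
    then show ?case
      using lex_less_trans lex_less_irrefl by (cases "lex_less a x") blast+
  qed
  from this[of "{..<n}"] obtain x where x: "\<forall>y<n. \<not> lex_less y x"
    using n_pos by auto
  have "\<not> lex_less y x" for y
  proof -
    have "\<not> lex_less (y mod n) x" using x n_pos by simp
    then show ?thesis using lex_less_cong[OF d_mod[OF period_n, of y] refl] by simp
  qed
  then show ?thesis by (auto simp: least_rotation_def)
qed

lemma ex_least_rotation_below:
  assumes "period q" "0 < q"
  obtains x where "x < q" "least_rotation x"
proof -
  obtain x where "least_rotation x" using ex_least_rotation ..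
  then show ?thesis
    using that[of "x mod q"] least_rotation_mod[OF assms(1)] assms(2) by simp
qed

text \<open>The last conjunct records what the search has ruled out: every position below the larger
  pointer, except the pointers themselves. Nothing is claimed beyond it.\<close>

definition search_inv :: "nat \<Rightarrow> nat \<Rightarrow> nat \<Rightarrow> bool" where
  "search_inv i j k \<longleftrightarrow> i \<noteq> j \<and> (\<forall>t<k. d (i + t) = d (j + t)) \<and>
     (\<forall>x < max i j. least_rotation x \<longrightarrow> x = i \<or> x = j)"

lemma search_inv_commute: "search_inv i j k \<longleftrightarrow> search_inv j i k"
  unfolding search_inv_def max.commute[of i j] eq_commute[of i j] eq_commute[of "d (i + _)"] by blast

lemma search_inv_init: "search_inv 0 1 0"
  by (auto simp: search_inv_def)

lemma search_inv_equal:
  "search_inv i j k \<Longrightarrow> d (i + k) = d (j + k) \<Longrightarrow> search_inv i j (Suc k)"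
  unfolding search_inv_def less_Suc_eq by blast

lemma not_least_rotation:
  assumes "\<forall>t<k. d (i + t) = d (j + t)" "d (j + k) < d (i + k)" "i \<le> x" "x \<le> i + k"
  shows "\<not> least_rotation x"
proof -
  let ?e = "x - i"
  \<comment> \<open>Dropping the first \<open>x - i\<close> entries from both rotations leaves the
    mismatch at offset \<open>k\<close> in place, now at offset \<open>k - ?e\<close>.\<close>
  have "\<forall>t < k - ?e. d (j + ?e + t) = d (x + t)"
  proof (intro allI impI)
    fix t assume "t < k - ?e"
    then have "d (i + (?e + t)) = d (j + (?e + t))" using assms(1) by simp
    then show "d (j + ?e + t) = d (x + t)" using assms(3) by (simp add: add.assoc[symmetric])
  qed
  moreover have "j + ?e + (k - ?e) = j + k" "x + (k - ?e) = i + k"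
    using assms(3,4) by auto
  ultimately have "lex_less (j + ?e) x"
    unfolding lex_less_def using assms(2) by metis
  then show ?thesis by (auto simp: least_rotation_def)
qed

text \<open>If the skipping pointer lands on the other one, the latter moves one further to keep
  them distinct; this newly covers only the position \<open>j\<close>, which is \<open>i'\<close>
  itself.\<close>

lemma search_inv_skip:
  assumes "search_inv i j k" "d (j + k) < d (i + k)" "i' = Suc (i + k)"
  shows "if i' = j then search_inv i' (Suc j) 0 else search_inv i' j 0"
proof -
  have "\<not> least_rotation x" if "i \<le> x" "x < i'" for x
    using not_least_rotation[of k i j x] assms that by (auto simp: search_inv_def)
  moreover have "x = i \<or> x = j" if "least_rotation x" "x < max i j" for x
    using assms(1) that by (auto simp: search_inv_def)
  ultimately have "x = i' \<or> x = j" if "least_rotation x" "x < max i' j" for x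
    using that by (metis less_max_iff_disj linorder_not_less order_refl assms(3) le_add1 le_imp_less_Suc)
  then show ?thesis by (auto simp: search_inv_def less_Suc_eq)
qed

text \<open>A period \<open>q < n\<close> would give two distinct least rotations below
  \<open>n\<close>, namely \<open>x\<close> and \<open>(x + q) mod n\<close>. The invariant makes
  them the two pointers, but one pointer is at least \<open>n\<close>.\<close>

lemma minimal_period_n:
  assumes "search_inv i j k" "n \<le> i \<or> n \<le> j"
  shows "minimal_period n"
proof -
  have False if q: "0 < q" "period q" "q < n" for q
  proof -
    obtain x where x: "x < n" "least_rotation x"
      using ex_least_rotation_below[OF period_n n_pos] .
    let ?y = "(x + q) mod n"
    have y: "?y < n" "least_rotation ?y"
      using n_pos x least_rotation_mod[OF period_n] least_rotation_add[OF q(2)] by auto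
    have "?y \<noteq> x"
    proof
      assume "?y = x"
      then show False
        using x q by (cases "x + q < n") (auto simp: le_mod_geq)
    qed
    moreover have "x < max i j" "?y < max i j"
      using assms(2) x(1) y(1) by (metis less_max_iff_disj order_less_le_trans)+
    ultimately show False
      using assms x y unfolding search_inv_def by (metis linorder_not_less)
  qed
  then show ?thesis
    unfolding minimal_period_def using n_pos period_n by (meson linorder_not_less)
qed

text \<open>Agreement on \<open>n\<close> entries extends to all entries by periodicity, so
  \<open>j - i\<close> is a period. A smaller period \<open>q\<close> would make both
  \<open>i\<close> and \<open>i + q\<close> least, although \<open>i\<close> is the only candidate
  below \<open>j\<close>.\<close>

lemma minimal_period_search:
  assumes "search_inv i j n" "i < j"
  shows "minimal_period (j - i)"
proof -
  have eq: "d (i + t) = d (j + t)" for t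
  proof -
    have "d (i + t mod n) = d (j + t mod n)"
      using assms(1) n_pos by (simp add: search_inv_def)
    then show ?thesis
      using d_mod[OF period_n, of t] by (simp add: add.commute)
  qed
  have "period (j - i)"
    unfolding period_def
  proof
    fix x
    \<comment> \<open>Adding the period multiple \<open>i * n\<close> pushes the argument past
      \<open>i\<close>, where \<open>eq\<close> applies.\<close>
    have i: "i \<le> i * n" using n_pos by simp
    have "d (x + (j - i)) = d (x + (j - i) + i * n)"
      using period_mult[OF period_n] by (simp add: period_def)
    also have "x + (j - i) + i * n = j + (x + (i * n - i))"
      using assms(2) i by linarith
    also have "d \<dots> = d (i + (x + (i * n - i)))" by (simp only: eq)
    also have "i + (x + (i * n - i)) = x + i * n" using i by linarith
    also have "d \<dots> = d x" using period_mult[OF period_n] by (simp add: period_def)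
    finally show "d (x + (j - i)) = d x" .
  qed
  moreover have False if q: "0 < q" "period q" "q < j - i" for q
  proof -
    have only: "x = i" if "x < j" "least_rotation x" for x
      using assms that by (auto simp: search_inv_def)
    obtain x where "x < q" "least_rotation x"
      using ex_least_rotation_below[OF q(2,1)] .
    then have "least_rotation i" using only[of x] q(3) by simp
    then have "least_rotation (i + q)" using least_rotation_add q(2) by blast
    then show False using only[of "i + q"] q by linarith
  qed
  ultimately show ?thesis
    unfolding minimal_period_def using assms(2) by (meson linorder_not_less zero_less_diff)
qed

end

subsection \<open>Symmetries as periods of the gap sequence\<close>

locale residue_set =
  fixes m :: nat and A :: "nat set"
  assumes A_nonempty: "A \<noteq> {}" and A_less: "A \<subseteq> {..<m}"
begin

definition n :: nat where
  "n = card A"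

definition ext :: "nat \<Rightarrow> nat" where
  "ext x = sorted_list_of_set A ! (x mod n) + m * (x div n)"

definition gap :: "nat \<Rightarrow> nat" where
  "gap x = ext (Suc x) - ext x"

lemma finite_A: "finite A"
  using A_less finite_subset by blast

lemma card_pos: "0 < n"
  using A_nonempty finite_A by (simp add: n_def card_gt_0_iff)

lemma n_le_m: "n \<le> m"
  using card_mono[OF finite_lessThan A_less] by (simp add: n_def)

lemma length_elems: "length (sorted_list_of_set A) = n"
  by (simp add: n_def)

lemma elem_in_A: "x < n \<Longrightarrow> sorted_list_of_set A ! x \<in> A"
  by (metis finite_A length_elems nth_mem set_sorted_list_of_set)

lemma ext_less_n: "x < n \<Longrightarrow> ext x = sorted_list_of_set A ! x"
  by (simp add: ext_def)

lemma ext_add_mult_n: "ext (x + q * n) = ext x + q * m"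
  using card_pos by (simp add: ext_def algebra_simps)

lemma ext_add_n: "ext (x + n) = ext x + m"
  using ext_add_mult_n[of x 1] by simp

lemma ext_mod: "ext x mod m \<in> A"
proof -
  have "sorted_list_of_set A ! (x mod n) \<in> A"
    using elem_in_A card_pos by simp
  then show ?thesis using A_less by (auto simp: ext_def)
qed

lemma ext_less_Suc: "ext x < ext (Suc x)"
proof (cases "Suc (x mod n) < n")
  case True
  then have "Suc x mod n = Suc (x mod n)" "Suc x div n = x div n"
    by (simp_all add: mod_Suc div_Suc)
  moreover have "sorted_list_of_set A ! (x mod n) < sorted_list_of_set A ! Suc (x mod n)"
    using True strict_sorted_list_of_set[of A] length_elems
    by (simp add: sorted_wrt_nth_less)
  ultimately show ?thesis by (simp add: ext_def)
next
  case False
  then have "Suc (x mod n) = n" using card_pos mod_less_divisor[of n x] by linarith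
  then have "Suc x mod n = 0" "Suc x div n = Suc (x div n)"
    by (simp_all add: mod_Suc div_Suc)
  moreover have "sorted_list_of_set A ! (x mod n) < m"
    using elem_in_A[of "x mod n"] card_pos A_less by auto
  ultimately show ?thesis by (simp add: ext_def)
qed

lemma ext_strict_mono: "strict_mono ext"
  by (simp add: strict_mono_Suc_iff ext_less_Suc)

lemma ext_eq_add_gap: "ext (Suc x) = ext x + gap x"
  using ext_less_Suc[of x] by (simp add: gap_def)

text \<open>Together with \<open>ext_mod\<close> and \<open>ext_strict_mono\<close>, this makes
  \<open>ext\<close> the increasing enumeration of all naturals whose residue lies in
  \<open>A\<close>.\<close>

lemma ex_ext:
  assumes "y mod m \<in> A"
  obtains x where "ext x = y"
proof -
  obtain i where i: "i < n" "sorted_list_of_set A ! i = y mod m"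
    using assms finite_A by (metis in_set_conv_nth length_elems set_sorted_list_of_set)
  have "ext (i + y div m * n) = y"
    using i by (simp add: ext_add_mult_n ext_less_n)
  then show ?thesis using that by blast
qed

sublocale cyclic_sequence gap n
proof
  show "gap (x + n) = gap x" for x
    using ext_add_n[of x] ext_add_n[of "Suc x"] by (simp add: gap_def)
qed (rule card_pos)

lemma ext_add_period:
  assumes "period j"
  shows "ext (x + j) = ext x + (ext j - ext 0)"
proof (induction x)
  case 0
  then show ?case using strict_mono_less_eq[OF ext_strict_mono, of 0 j] by simp
next
  case (Suc x)
  then show ?case
    using assms ext_eq_add_gap[of x] ext_eq_add_gap[of "x + j"] by (simp add: period_def)
qed

text \<open>Translation is injective on residues, so on the finite set \<open>A\<close> mapping into
  \<open>A\<close> already means mapping onto \<open>A\<close>.\<close>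

lemma Sym_iff: "h \<in> Sym m A \<longleftrightarrow> h < m \<and> (\<forall>a\<in>A. (a + h) mod m \<in> A)"
proof -
  have "(\<lambda>a. (a + h) mod m) ` A = A" if "h < m" and sub: "\<forall>a\<in>A. (a + h) mod m \<in> A"
  proof (rule endo_inj_surj[OF finite_A])
    show "inj_on (\<lambda>a. (a + h) mod m) A"
    proof (rule inj_onI)
      fix a b assume "a \<in> A" "b \<in> A" and eq: "(a + h) mod m = (b + h) mod m"
      then have "a < m" "b < m" using A_less by auto
      then show "a = b" using eq \<open>h < m\<close>
        by (cases "a + h < m"; cases "b + h < m") (auto simp: le_mod_geq)
    qed
  qed (use sub in auto)
  then show ?thesis by (auto simp: Sym_def)
qed

lemma period_in_Sym:
  assumes "j < n" "period j"
  shows "ext j - ext 0 \<in> Sym m A"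
  unfolding Sym_iff
proof
  show "ext j - ext 0 < m"
    using strict_monoD[OF ext_strict_mono assms(1)] ext_add_n[of 0] card_pos n_le_m
    by simp
  show "\<forall>a\<in>A. (a + (ext j - ext 0)) mod m \<in> A"
  proof
    fix a assume "a \<in> A"
    then have "a mod m \<in> A" using A_less by auto
    then obtain x where "ext x = a" by (rule ex_ext)
    then show "(a + (ext j - ext 0)) mod m \<in> A"
      using ext_add_period[OF assms(2), of x] ext_mod[of "x + j"] by simp
  qed
qed

text \<open>
  A symmetry induces a strictly increasing self-map \<open>f\<close> of the indices with \<open>f (q * n) = f 0 + q * n\<close>;
  there is no room for such a map to be anything but a shift.
\<close>

lemma Sym_period:
  assumes h: "h \<in> Sym m A"
  obtains j where "j < n" "period j" "h = ext j - ext 0"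
proof -
  have "\<exists>y. ext y = ext x + h" for x
  proof -
    have "(ext x mod m + h) mod m \<in> A" using h ext_mod by (simp add: Sym_iff)
    then have "(ext x + h) mod m \<in> A" by (simp add: mod_add_left_eq)
    then show ?thesis using ex_ext by metis
  qed
  then obtain f where f: "\<And>x. ext (f x) = ext x + h" by metis
  have "strict_mono f"
    by (rule strict_monoI) (metis add_less_cancel_right ext_strict_mono f strict_mono_less)
  then have mono: "f x + k \<le> f (x + k)" for x k
  proof (induction k)
    case (Suc k)
    then show ?case using strict_monoD[OF Suc.prems, of "x + k" "Suc (x + k)"] by fastforce
  qed simp
  have mult: "f (q * n) = f 0 + q * n" for q
  proof -
    have "ext (f (q * n)) = ext (f 0 + q * n)"
      using f[of "q * n"] f[of 0] ext_add_mult_n[of 0 q] by (simp add: ext_add_mult_n)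
    then show ?thesis using strict_mono_eq[OF ext_strict_mono] by blast
  qed
  have shift: "f x = x + f 0" for x
  proof (rule antisym)
    \<comment> \<open>At \<open>x * n\<close> the value of \<open>f\<close> is known exactly; since
      \<open>f\<close> grows by at least 1 per step from \<open>x\<close> up to there,
      \<open>f x\<close> is bounded above.\<close>
    have "x \<le> x * n" using card_pos by simp
    then show "f x \<le> x + f 0" using mono[of x "x * n - x"] mult[of x] by simp
    show "x + f 0 \<le> f x" using mono[of 0 x] by simp
  qed
  have "gap (x + f 0) = gap x" for x
    using f[of x] f[of "Suc x"] by (simp add: gap_def shift[of x] shift[of "Suc x"])
  then have "period (f 0)" by (simp add: period_def)
  moreover have "ext (f 0) < ext n"
    using f[of 0] h ext_add_n[of 0] by (simp add: Sym_iff)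
  then have "f 0 < n" using strict_mono_less[OF ext_strict_mono] by blast
  moreover have "h = ext (f 0) - ext 0" using f[of 0] by simp
  ultimately show ?thesis using that by blast
qed

lemma sorted_list_of_Sym:
  assumes "minimal_period p"
  shows "sorted_list_of_set (Sym m A) = map (\<lambda>q. ext (q * p) - ext 0) [0..<n div p]"
proof -
  have p: "0 < p" "p dvd n"
    using assms minimal_period_dvd[OF assms period_n] by (auto simp: minimal_period_def)
  let ?f = "\<lambda>q. ext (q * p) - ext 0"
  have less: "?f q < ?f q'" if "q < q'" for q q'
  proof -
    have "ext 0 \<le> ext (q * p)" using strict_mono_less_eq[OF ext_strict_mono] by blast
    moreover have "ext (q * p) < ext (q' * p)"
      using p(1) that by (intro strict_monoD[OF ext_strict_mono]) simp
    ultimately show ?thesis by linarith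
  qed
  have lt: "q < n div p \<longleftrightarrow> q * p < n" for q
    using p by (auto elim!: dvdE simp: mult.commute)
  have "Sym m A = ?f ` {..<n div p}"
  proof (intro equalityI subsetI)
    fix h assume "h \<in> Sym m A"
    then obtain j where j: "j < n" "period j" "h = ext j - ext 0" by (rule Sym_period)
    obtain q where "j = q * p"
      using minimal_period_dvd[OF assms j(2)] by (metis dvdE mult.commute)
    then show "h \<in> ?f ` {..<n div p}" using j lt by auto
  next
    fix h assume "h \<in> ?f ` {..<n div p}"
    then obtain q where "q * p < n" "h = ?f q" using lt by auto
    then show "h \<in> Sym m A"
      using period_in_Sym[of "q * p"] period_mult assms by (simp add: minimal_period_def)
  qed
  then have "set (map ?f [0..<n div p]) = Sym m A" by (simp add: atLeast0LessThan)
  moreover have "sorted_wrt (<) (map ?f [0..<n div p])"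
    using less by (auto simp: sorted_wrt_iff_nth_less)
  ultimately show ?thesis
    by (metis List.finite_set sorted_list_of_set.idem_if_sorted_distinct strict_sorted_iff)
qed

end

subsection \<open>The program\<close>

text \<open>Halting is left to \<open>Q\<close>, so that the step bounds of consecutive phases
  simply add up.\<close>

definition reaches :: "nat \<Rightarrow> instr list \<Rightarrow> nat \<Rightarrow> config \<Rightarrow> (config \<Rightarrow> bool) \<Rightarrow> bool" where
  "reaches w P T s Q \<longleftrightarrow> (\<exists>t\<le>T. Q ((step w P ^^ t) s))"

lemma reaches_refl: "Q s \<Longrightarrow> reaches w P T s Q"
  unfolding reaches_def by (intro exI[of _ 0]) simp

lemma reaches_steps:
  assumes "reaches w P T ((step w P ^^ k) s) Q" "k + T \<le> T'"
  shows "reaches w P T' s Q"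
proof -
  obtain t where "t \<le> T" "Q ((step w P ^^ t) ((step w P ^^ k) s))"
    using assms(1) by (auto simp: reaches_def)
  moreover have "(step w P ^^ t) ((step w P ^^ k) s) = (step w P ^^ (t + k)) s"
    by (simp add: funpow_add)
  ultimately show ?thesis
    using assms(2) unfolding reaches_def by (intro exI[of _ "t + k"]) simp
qed

lemma reaches_trans:
  assumes "reaches w P T s Q" "\<And>s. Q s \<Longrightarrow> reaches w P T' s Q'"
  shows "reaches w P (T + T') s Q'"
proof -
  obtain t where "t \<le> T" "Q ((step w P ^^ t) s)"
    using assms(1) by (auto simp: reaches_def)
  then show ?thesis by (intro reaches_steps[OF assms(2)]) auto
qed

text \<open>Peels off the first step rather than the last, so that rewriting executes a fixed number
  of instructions in program order.\<close>

lemma funpow_numeral_swap: "(f ^^ numeral k) x = (f ^^ pred_numeral k) (f x)"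
  by (simp add: numeral_eq_Suc funpow_swap1)

text \<open>
  Registers: 0, 1, 2 hold \<open>m\<close>, \<open>n\<close>, 1; from line 9 on, 3 holds \<open>a 0\<close>; 7, 8, 9 are the search
  variables \<open>i\<close>, \<open>j\<close>, \<open>k\<close>, and 8 finally holds \<open>p\<close>; 14 and 15 are the write and read positions of
  the output. Lines 2-8 store \<open>a n, \<dots>, a (2 * n)\<close> behind the input, lines 11-38 are the search,
  39-44 compute \<open>p\<close>, and 45-52 overwrite the input by the values \<open>a (q * p) - a 0\<close>.
\<close>

definition sym_program :: "instr list" where
  "sym_program =
    [Const 2 1, Move 3 1,
     JumpLess 1 4 9, Load 5 4, Add 5 5 0, Store 3 5, Add 3 3 2, Add 4 4 2, Jump 2,
     Load 3 6, Move 8 2,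
     JumpLess 7 1 13, Jump 39, JumpLess 8 1 15, Jump 39, JumpEq 9 1 41,
     Add 10 7 9, Add 11 8 9, Load 12 10, Load 13 11, Add 10 10 2, Add 11 11 2,
     Load 10 10, Load 11 11, Sub 10 10 12, Sub 11 11 13, JumpEq 10 11 37,
     Add 9 9 2, JumpLess 10 11 31,
     Add 7 7 9, Jump 32, Add 8 8 9, Const 9 0, JumpEq 7 8 35, Jump 11, Add 8 8 2, Jump 11,
     Add 9 9 2, Jump 11,
     Move 8 1, Const 7 0,
     JumpLess 7 8 44, Sub 8 7 8, Jump 45, Sub 8 8 7,
     JumpLess 15 1 47, Jump 53, Load 10 15, Sub 10 10 3, Store 14 10, Add 14 14 2, Add 15 15 8,
     Jump 45,
     Move 1 14]"

lemma length_sym_program: "length sym_program = 54"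
  by (simp add: sym_program_def)

lemmas sym_program_nth = fun_cong[OF arg_cong[OF sym_program_def, of nth]]

lemmas exec_simps =
  step_def halted_def length_sym_program funpow_numeral_swap set_reg_def sym_program_nth

lemma word_sub: "y \<le> x \<Longrightarrow> x < 2 ^ w \<Longrightarrow> (x + (2 ^ w - y)) mod 2 ^ w = x - (y :: nat)"
  using mod_add_self2[of "x - y" "2 ^ w"] by simp

locale residue_set_word = residue_set +
  fixes w :: nat
  \<comment> \<open>Extended values stay below \<open>3 * m\<close> and addresses do not exceed
    about \<open>2 * n\<close>, so the factor 4 rules out overflow.\<close>
  assumes word_size: "4 * m \<le> 2 ^ w"
begin

lemma ext_bound:
  assumes "y \<le> 2 * n"
  shows "ext y < 3 * m"
proof -
  have "ext y \<le> ext (0 + 2 * n)"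
    using assms strict_mono_less_eq[OF ext_strict_mono] by simp
  moreover have "ext 0 < m"
    using ext_less_n[OF card_pos] elem_in_A[OF card_pos] A_less by auto
  ultimately show ?thesis using ext_add_mult_n[of 0 2] by simp
qed

text \<open>Register 6 is the address from which \<open>ext 0\<close> is loaded; the other registers
  required to be 0 are starting values of later phases.\<close>

definition copied :: "config \<Rightarrow> bool" where
  "copied s \<longleftrightarrow> pc s = 9 \<and> reg s 1 = n \<and> reg s 2 = 1 \<and>
     reg s 6 = 0 \<and> reg s 7 = 0 \<and> reg s 9 = 0 \<and> reg s 14 = 0 \<and> reg s 15 = 0 \<and>
     (\<forall>y\<le>2 * n. mem s y = ext y)"

lemma copy_loop:
  assumes "pc s = 2" "reg s 0 = m" "reg s 1 = n" "reg s 2 = 1" "reg s 3 = n + x" "reg s 4 = x"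
    "reg s 6 = 0" "reg s 7 = 0" "reg s 9 = 0" "reg s 14 = 0" "reg s 15 = 0"
    "\<forall>y<n + x. mem s y = ext y" "x \<le> Suc n"
  shows "reaches w sym_program (7 * (Suc n - x) + 1) s copied"
  using assms
proof (induction "Suc n - x" arbitrary: x s)
  case 0
  then have x: "x = Suc n" by simp
  show ?case
  proof (rule reaches_steps[where k = 1])
    show "reaches w sym_program 0 ((step w sym_program ^^ 1) s) copied"
      using 0 x by (intro reaches_refl) (simp add: exec_simps copied_def)
  qed simp
next
  case (Suc N)
  then have x: "x \<le> n" "N = Suc n - Suc x" by auto
  have bounds: "ext x + m < 2 ^ w" "Suc (n + x) < 2 ^ w" "Suc x < 2 ^ w"
    using ext_bound[of x] x n_le_m card_pos word_size by auto
  \<comment> \<open>In the last iteration, \<open>x = n\<close>, this cell is the one written in the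
    iteration \<open>x = 0\<close>.\<close>
  have mem_x: "mem s x = ext x" using Suc.prems(12) card_pos by simp
  let ?s = "(step w sym_program ^^ 7) s"
  have s: "?s = s\<lparr>pc := 2, reg := (reg s)(5 := ext x + m, 3 := n + Suc x, 4 := Suc x),
      mem := (mem s)(n + x := ext x + m)\<rparr>"
    using Suc.prems x bounds mem_x by (simp add: exec_simps)
  have "reaches w sym_program (7 * (Suc n - Suc x) + 1) ?s copied"
  proof (rule Suc.hyps(1)[OF x(2)])
    show "\<forall>y<n + Suc x. mem ?s y = ext y"
      using Suc.prems(12) ext_add_n[of x] by (auto simp: s less_Suc_eq add.commute)
  qed (use Suc.prems x in \<open>simp_all add: s\<close>)
  then show ?case by (rule reaches_steps) (use x in auto)
qed

section \<open>The search phase and the output phase\<close>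

definition searching :: "nat \<Rightarrow> nat \<Rightarrow> nat \<Rightarrow> config \<Rightarrow> bool" where
  "searching i j k s \<longleftrightarrow> pc s = 11 \<and> reg s 1 = n \<and> reg s 2 = 1 \<and> reg s 3 = ext 0 \<and>
     reg s 7 = i \<and> reg s 8 = j \<and> reg s 9 = k \<and> reg s 14 = 0 \<and> reg s 15 = 0 \<and>
     (\<forall>y\<le>2 * n. mem s y = ext y)"

text \<open>The output overwrites the input in place. For positive \<open>p\<close> the read
  position \<open>q * p\<close> is never behind the write position \<open>q\<close>, so entries
  still to be read are intact.\<close>

definition writing :: "nat \<Rightarrow> nat \<Rightarrow> config \<Rightarrow> bool" where
  "writing p q s \<longleftrightarrow> pc s = 45 \<and> reg s 1 = n \<and> reg s 2 = 1 \<and> reg s 3 = ext 0 \<and>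
     reg s 8 = p \<and> reg s 14 = q \<and> reg s 15 = q * p \<and>
     (\<forall>y<q. mem s y = ext (y * p) - ext 0) \<and> (\<forall>y. q \<le> y \<longrightarrow> y < n \<longrightarrow> mem s y = ext y)"

text \<open>The weight 2 on the pointers pays for resetting \<open>k\<close>: a skip gains at least
  \<open>2 * (k + 1)\<close> and loses only \<open>k\<close>.\<close>

lemma search_step:
  assumes s: "searching i j k s" and inv: "search_inv i j k" and lt: "i < n" "j < n" "k < n"
  obtains t i' j' k' where "t \<le> 22" "searching i' j' k' ((step w sym_program ^^ t) s)"
    "search_inv i' j' k'" "2 * (i + j) + k < 2 * (i' + j') + k'" "k' \<le> n"
proof -
  have mem: "mem s (i + k) = ext (i + k)" "mem s (Suc (i + k)) = ext (Suc (i + k))"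
    "mem s (j + k) = ext (j + k)" "mem s (Suc (j + k)) = ext (Suc (j + k))"
    using s lt by (simp_all add: searching_def)
  have ext: "ext (i + k) \<le> ext (Suc (i + k))" "ext (Suc (i + k)) < 2 ^ w"
    "ext (j + k) \<le> ext (Suc (j + k))" "ext (Suc (j + k)) < 2 ^ w"
    using ext_less_Suc[of "i + k"] ext_less_Suc[of "j + k"]
      ext_bound[of "Suc (i + k)"] ext_bound[of "Suc (j + k)"] lt word_size by auto
  have bounds: "Suc (i + k) < 2 ^ w" "Suc (j + k) < 2 ^ w" "i + k < 2 ^ w" "j + k < 2 ^ w"
     "Suc k < 2 ^ w" "Suc (Suc (i + k)) < 2 ^ w" "Suc (Suc (j + k)) < 2 ^ w"
    using lt n_le_m word_size by auto
  note regs = s[unfolded searching_def]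
  \<comment> \<open>The prefix common to all cases: three exit tests, then both gaps are computed.
    Instruction 26 compares them.\<close>
  define s' where "s' = (step w sym_program ^^ 13) s"
  have s': "s' = s\<lparr>pc := 26, reg := (reg s)(12 := ext (i + k), 13 := ext (j + k),
      10 := gap (i + k), 11 := gap (j + k))\<rparr>"
    using regs mem bounds lt word_sub[OF ext(1,2)] word_sub[OF ext(3,4)]
    by (simp add: s'_def exec_simps gap_def fun_upd_twist)
  have add_steps: "(step w sym_program ^^ (t + 13)) s = (step w sym_program ^^ t) s'" for t
    by (simp add: s'_def funpow_add)
  have regs': "pc s' = 26" "reg s' 1 = n" "reg s' 2 = 1" "reg s' 3 = ext 0"
    "reg s' 7 = i" "reg s' 8 = j" "reg s' 9 = k" "reg s' 14 = 0" "reg s' 15 = 0"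
    "reg s' 10 = gap (i + k)" "reg s' 11 = gap (j + k)" "\<forall>y\<le>2 * n. mem s' y = ext y"
    using regs by (simp_all add: s')
  consider "gap (i + k) = gap (j + k)" | "gap (j + k) < gap (i + k)" | "gap (i + k) < gap (j + k)"
    by linarith
  then show ?thesis
  proof cases
    case 1
    have "searching i j (Suc k) ((step w sym_program ^^ 3) s')"
      using regs' bounds 1 by (simp add: exec_simps searching_def)
    then show ?thesis
      using that[of "3 + 13" i j "Suc k"] search_inv_equal[OF inv 1] lt unfolding add_steps by simp
  next
    case 2
    let ?i = "Suc (i + k)"
    show ?thesis
    proof (cases "?i = j")
      case True
      have "searching ?i (Suc j) 0 ((step w sym_program ^^ 9) s')"
        using regs' bounds 2 True by (simp add: exec_simps searching_def)
      then show ?thesis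
        using that[of "9 + 13" ?i "Suc j" 0] search_inv_skip[OF inv 2 refl] True
        unfolding add_steps by simp
    next
      case False
      have "searching ?i j 0 ((step w sym_program ^^ 8) s')"
        using regs' bounds 2 False by (simp add: exec_simps searching_def)
      then show ?thesis
        using that[of "8 + 13" ?i j 0] search_inv_skip[OF inv 2 refl] False
        unfolding add_steps by simp
    qed
  next
    case 3
    let ?j = "Suc (j + k)"
    have inv': "search_inv j i k" using inv search_inv_commute by blast
    show ?thesis
    proof (cases "?j = i")
      case True
      have "searching i (Suc ?j) 0 ((step w sym_program ^^ 8) s')"
        using regs' bounds 3 True by (simp add: exec_simps searching_def)
      \<comment> \<open>When the pointers meet, the program advances \<open>j\<close>, whichever of
        them skipped. As \<open>?j = i\<close>, this is the pair that \<open>search_inv_skip\<close>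
        yields with the roles swapped.\<close>
      moreover have "search_inv i (Suc ?j) 0"
        using search_inv_skip[OF inv' 3 refl] True by simp
      ultimately show ?thesis
        using that[of "8 + 13" i "Suc ?j" 0] unfolding add_steps by simp
    next
      case False
      have "searching i ?j 0 ((step w sym_program ^^ 7) s')"
        using regs' bounds 3 False by (simp add: exec_simps searching_def)
      moreover have "search_inv i ?j 0"
        using search_inv_skip[OF inv' 3 refl] False search_inv_commute by simp
      ultimately show ?thesis
        using that[of "7 + 13" i ?j 0] unfolding add_steps by simp
    qed
  qed
qed

lemma search_exit:
  assumes s: "searching i j k s" and inv: "search_inv i j k" and "n \<le> i \<or> n \<le> j \<or> k = n"
  obtains t p where "t \<le> 10" "minimal_period p" "writing p 0 ((step w sym_program ^^ t) s)"
proof -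
  note regs = s[unfolded searching_def]
  have pos: "0 < n" "n < 2 ^ w" using card_pos n_le_m word_size by auto
  consider "n \<le> i" | "i < n" "n \<le> j" | "i < n" "j < n" "k = n"
    using assms(3) by linarith
  then show ?thesis
  proof cases
    case 1
    \<comment> \<open>Once a pointer is out of range, the program resets the pointers to 0 and
      \<open>n\<close>, so the shared difference code yields \<open>n\<close>.\<close>
    have "writing n 0 ((step w sym_program ^^ 6) s)"
      using regs pos 1 by (simp add: exec_simps writing_def)
    then show ?thesis using that[of 6 n] minimal_period_n[OF inv] 1 by simp
  next
    case 2
    have "writing n 0 ((step w sym_program ^^ 7) s)"
      using regs pos 2 by (simp add: exec_simps writing_def)
    then show ?thesis using that[of 7 n] minimal_period_n[OF inv] 2 by simp
  next
    case 3
    show ?thesis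
    proof (cases "i < j")
      case True
      have "(j + (2 ^ w - i)) mod 2 ^ w = j - i"
        using word_sub True 3 pos by simp
      then have "writing (j - i) 0 ((step w sym_program ^^ 5) s)"
        using regs pos 3 True by (simp add: exec_simps writing_def)
      then show ?thesis
        using that[of 5 "j - i"] minimal_period_search inv True 3 by simp
    next
      case False
      then have "j < i" using inv by (simp add: search_inv_def)
      moreover have "(i + (2 ^ w - j)) mod 2 ^ w = i - j"
        using word_sub False 3 pos by simp
      then have "writing (i - j) 0 ((step w sym_program ^^ 6) s)"
        using regs pos 3 False by (simp add: exec_simps writing_def)
      ultimately show ?thesis
        using that[of 6 "i - j"] minimal_period_search inv search_inv_commute 3 by simp
    qed
  qed
qed

lemma search_loop:
  assumes "searching i j k s" "search_inv i j k" "k \<le> n"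
  shows "reaches w sym_program (22 * (5 * n - (2 * (i + j) + k)) + 10) s
    (\<lambda>s. \<exists>p. minimal_period p \<and> writing p 0 s)"
  using assms
proof (induction "5 * n - (2 * (i + j) + k)" arbitrary: i j k s rule: less_induct)
  case less
  show ?case
  proof (cases "i < n \<and> j < n \<and> k < n")
    case True
    then obtain t i' j' k' where t: "t \<le> 22" and s: "searching i' j' k' ((step w sym_program ^^ t) s)"
      and inv: "search_inv i' j' k'" and gt: "2 * (i + j) + k < 2 * (i' + j') + k'" and k: "k' \<le> n"
      using search_step[OF less.prems(1,2)] by metis
    \<comment> \<open>The old measure is below \<open>5 * n\<close>, so the truncated difference
      drops however large the new measure is.\<close>
    have dec: "5 * n - (2 * (i' + j') + k') < 5 * n - (2 * (i + j) + k)"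
      using True gt by (intro diff_less_mono2) auto
    show ?thesis
      by (rule reaches_steps[OF less.hyps[OF dec s inv k]]) (use t dec in linarith)
  next
    case False
    then have "n \<le> i \<or> n \<le> j \<or> k = n" using less.prems(3) by auto
    then obtain t p where "t \<le> 10" "minimal_period p" "writing p 0 ((step w sym_program ^^ t) s)"
      using search_exit[OF less.prems(1,2)] by metis
    then show ?thesis
      by (intro reaches_steps[where k = t and T = 0, OF reaches_refl]) auto
  qed
qed

lemma write_loop:
  assumes p: "minimal_period p" and "writing p q s" "q \<le> n div p"
  shows "reaches w sym_program (8 * (n div p - q) + 3) s
    (\<lambda>s. halted sym_program s \<and> output_list s = sorted_list_of_set (Sym m A))"
  using assms(2,3)
proof (induction "n div p - q" arbitrary: q s)
  case 0
  then have q: "q = n div p" by simp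
  have "q * p = n" using minimal_period_dvd[OF p period_n] q by simp
  let ?s = "(step w sym_program ^^ 3) s"
  have "halted sym_program ?s \<and> reg ?s 1 = q \<and> mem ?s = mem s"
    using 0(2) \<open>q * p = n\<close> by (simp add: exec_simps writing_def)
  moreover have "map (mem s) [0..<q] = map (\<lambda>q. ext (q * p) - ext 0) [0..<q]"
    using 0(2) by (simp add: writing_def)
  ultimately have "halted sym_program ?s \<and> output_list ?s = sorted_list_of_set (Sym m A)"
    using sorted_list_of_Sym[OF p] q by (simp add: output_list_def)
  then show ?case by (rule reaches_steps[where T = 0, OF reaches_refl]) simp
next
  case (Suc N)
  then have q: "q < n div p" "N = n div p - Suc q" by auto
  have p0: "0 < p" "p \<le> n"
    using p n_pos minimal_period_dvd[OF p period_n] dvd_imp_le by (auto simp: minimal_period_def)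
  have "q * p < n div p * p" using q(1) p0(1) by (rule mult_less_mono1)
  then have qp: "q * p < n" using minimal_period_dvd[OF p period_n] by simp
  \<comment> \<open>Hence the cell \<open>q * p\<close> has not been overwritten yet.\<close>
  have "q * 1 \<le> q * p" using p0 by (intro mult_le_mono) auto
  then have q_le: "q \<le> q * p" by simp
  note regs = Suc.prems(1)[unfolded writing_def]
  have mem: "mem s (q * p) = ext (q * p)" using regs qp q_le by blast
  have "ext 0 \<le> ext (q * p)" using strict_mono_less_eq[OF ext_strict_mono] by blast
  moreover have "ext (q * p) < 2 ^ w" using ext_bound[of "q * p"] qp word_size by simp
  ultimately have sub: "(ext (q * p) + (2 ^ w - ext 0)) mod 2 ^ w = ext (q * p) - ext 0"
    by (rule word_sub)
  have bounds: "Suc q < 2 ^ w" "q * p + p < 2 ^ w"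
    using qp q_le p0 n_le_m word_size by linarith+
  let ?s = "(step w sym_program ^^ 7) s"
  have s: "?s = s\<lparr>pc := 45, reg := (reg s)(10 := ext (q * p) - ext 0, 14 := Suc q, 15 := q * p + p),
      mem := (mem s)(q := ext (q * p) - ext 0)\<rparr>"
    using regs qp mem sub bounds by (simp add: exec_simps)
  have "writing p (Suc q) ?s"
    using regs by (simp add: s writing_def less_Suc_eq)
  then have "reaches w sym_program (8 * (n div p - Suc q) + 3) ?s
      (\<lambda>s. halted sym_program s \<and> output_list s = sorted_list_of_set (Sym m A))"
    using q by (intro Suc.hyps(1)) auto
  then show ?case by (rule reaches_steps) (use q in auto)
qed

lemma outputs_Sym:
  "outputs_within w sym_program (init_config m (sorted_list_of_set A)) (200 * card A)
     (sorted_list_of_set (Sym m A))"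
proof -
  let ?s0 = "init_config m (sorted_list_of_set A)"
  let ?done = "\<lambda>s. halted sym_program s \<and> output_list s = sorted_list_of_set (Sym m A)"
  \<comment> \<open>With \<open>w = 0\<close> the constant 1 would be reduced to 0.\<close>
  have word: "0 < w" using card_pos n_le_m word_size by (cases w) auto
  have init: "(step w sym_program ^^ 2) ?s0 = ?s0\<lparr>pc := 2, reg := (reg ?s0)(2 := 1, 3 := n)\<rparr>"
    using word length_elems by (simp add: exec_simps init_config_def)
  have "reaches w sym_program (7 * (Suc n - 0) + 1) ((step w sym_program ^^ 2) ?s0) copied"
    unfolding init
    by (rule copy_loop) (use length_elems in \<open>simp_all add: init_config_def ext_less_n\<close>)
  then have copy: "reaches w sym_program (7 * n + 10) ?s0 copied"
    by (rule reaches_steps) simp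
  have search: "reaches w sym_program (110 * n + 12) s (\<lambda>s. \<exists>p. minimal_period p \<and> writing p 0 s)"
    if "copied s" for s
  proof -
    have "searching 0 1 0 ((step w sym_program ^^ 2) s)"
      using that by (simp add: exec_simps searching_def copied_def)
    from search_loop[OF this search_inv_init] show ?thesis
      by (rule reaches_steps) simp_all
  qed
  have "reaches w sym_program (8 * n + 3) s ?done" if "minimal_period p" "writing p 0 s" for p s
  proof (rule reaches_steps[where k = 0])
    show "reaches w sym_program (8 * (n div p - 0) + 3) ((step w sym_program ^^ 0) s) ?done"
      using write_loop[OF that] by simp
  qed simp
  then have "reaches w sym_program (7 * n + 10 + (110 * n + 12 + (8 * n + 3))) ?s0 ?done"
    by (intro reaches_trans[OF copy] reaches_trans[OF search]) blast+
  \<comment> \<open>The sum is \<open>125 * n + 25\<close>, at most \<open>150 * n\<close> because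
    \<open>n\<close> is positive; \<open>110\<close> is 22 steps times the measure bound
    \<open>5 * n\<close>, per element.\<close>
  moreover have "7 * n + 10 + (110 * n + 12 + (8 * n + 3)) \<le> 200 * card A"
    using card_pos by (simp add: n_def)
  ultimately show ?thesis
    unfolding outputs_within_def reaches_def by (meson order_trans)
qed

end

theorem theorem6:
  "\<exists>(P :: instr list) (c :: nat) (k :: nat).
     \<forall>(m :: nat) (A :: nat set) (w :: nat).
       A \<noteq> {} \<and> A \<subseteq> {..<m} \<and> k * m \<le> 2 ^ w \<longrightarrow>
       outputs_within w P (init_config m (sorted_list_of_set A)) (c * card A)
         (sorted_list_of_set (Sym m A))"
proof (intro exI allI impI)
  fix m w :: nat and A :: "nat set"
  assume "A \<noteq> {} \<and> A \<subseteq> {..<m} \<and> 4 * m \<le> 2 ^ w"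
  then interpret residue_set_word m A w by unfold_locales auto
  show "outputs_within w sym_program (init_config m (sorted_list_of_set A)) (200 * card A)
      (sorted_list_of_set (Sym m A))"
    by (rule outputs_Sym)
qed

end
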